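(* For all $m,k\in\mathbb{N}$, $$S^{-m}\,\overline{\genfrac{[}{]}{0pt}{}{x}{k}}=\sum_{i=0}^{m}q^{(i-m)k}\genfrac{[}{]}{0pt}{}{m}{i}_q\,\overline{\genfrac{[}{]}{0pt}{}{x}{k-i}},$$ so that the coefficients expressing $S^{-m}\,\overline{\genfrac{[}{]}{0pt}{}{x}{k}}$ in the basis of the polynomials $\overline{\genfrac{[}{]}{0pt}{}{x}{j}}$, $j\in\mathbb{N}$, belong to $\mathbb{N}[q^{-1}]$.
   Context: Here $q$ and $x$ are commuting indeterminates, $\mathbb{N}=\{0,1,2,\dots\}$. For $n\in\mathbb{N}$, $[n]_q:=(q^n-1)/(q-1)$ and $[n]_q!:=[n]_q\cdots[1]_q$ with $[0]_q!:=1$. For $n,k\in\mathbb{N}$, $\genfrac{[}{]}{0pt}{}{n}{k}_q:=\frac{[n]_q!}{[n-k]_q![k]_q!}$ if $k\le n$ and $0$ if $k>n$. The $q$-binomial coefficient polynomials in $\mathbb{Q}(q)[x]$ are $\genfrac{[}{]}{0pt}{}{x}{k}:=\frac{x(x-[1]_q)\cdots(x-[k-1]_q)}{q^{\binom{k}{2}}[k]_q!}$ for $k\ge1$, $\genfrac{[}{]}{0pt}{}{x}{0}:=1$, and by convention $\genfrac{[}{]}{0pt}{}{x}{k}:=0$ for $k<0$. The shift operator $S$ is the $\mathbb{Q}(q)$-linear ring automorphism of $\mathbb{Q}(q)[x]$ with $S(x)=qx+1$, $S^{-1}(x)=q^{-1}(x-1)$. The bar involution $P\mapsto\overline{P}$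 is the ring involution of $\mathbb{Q}(q)[x]$ determined by $\overline{q}=q^{-1}$ (extended to the field involution of $\mathbb{Q}(q)$) and $\overline{x}=-qx$. $\mathbb{N}[q^{-1}]$ denotes polynomials in $q^{-1}$ with coefficients in $\mathbb{N}$. *)

theory Defs
  imports "HOL-Computational_Algebra.Computational_Algebra" "HOL-Computational_Algebra.Field_as_Ring"
begin

text \<open>The field of rational functions in \<open>q\<close> over the rationals is the fraction field of
  \<^typ>\<open>rat poly\<close>; polynomials in \<open>x\<close> over it are \<open>ratfun poly\<close>.\<close>

type_synonym ratfun = "rat poly fract"

definition qq :: ratfun where
  "qq = to_fract [:0, 1:]"

definition qint :: "nat \<Rightarrow> ratfun" where
  "qint n = (qq ^ n - 1) / (qq - 1)"

definition qfact :: "nat \<Rightarrow> ratfun" where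
  "qfact n = (\<Prod>j=1..n. qint j)"

definition qbinom :: "nat \<Rightarrow> nat \<Rightarrow> ratfun" where
  "qbinom n k = (if k \<le> n then qfact n / (qfact (n - k) * qfact k) else 0)"

text \<open>Since \<open>qint 0 = 0\<close>, the factor for \<open>j = 0\<close> is \<open>x\<close> itself; for \<open>k = 0\<close> the product is empty.\<close>

definition qbinom_poly :: "int \<Rightarrow> ratfun poly" where
  "qbinom_poly k =
     (if k < 0 then 0
      else smult (1 / (qq ^ (nat k choose 2) * qfact (nat k))) (\<Prod>j<nat k. [:- qint j, 1:]))"

definition nat_polys_in_inverse_q :: "ratfun set" where
  "nat_polys_in_inverse_q = range (\<lambda>p :: nat poly. poly (map_poly of_nat p) (inverse qq))"

definition qshift :: "ratfun poly \<Rightarrow> ratfun poly" where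
  "qshift P = pcompose P [:1, qq:]"

definition eval_inverse_q :: "rat poly \<Rightarrow> ratfun" where
  "eval_inverse_q p = poly (map_poly (\<lambda>c. to_fract [:c:]) p) (inverse qq)"

text \<open>\<open>a(q)/b(q)\<close> is sent to \<open>a(1/q)/b(1/q)\<close>; \<^const>\<open>quot_of_fract\<close> picks a reduced numerator and
  denominator, and \<open>bar_ratfun_Fract\<close> below shows that the choice is immaterial.\<close>

definition bar_ratfun :: "ratfun \<Rightarrow> ratfun" where
  "bar_ratfun f = eval_inverse_q (fst (quot_of_fract f)) / eval_inverse_q (snd (quot_of_fract f))"

definition qbar :: "ratfun poly \<Rightarrow> ratfun poly" where
  "qbar P = pcompose (map_poly bar_ratfun P) [:0, - qq:]"

interpretation ratfun_poly: vector_space "smult :: ratfun \<Rightarrow> ratfun poly \<Rightarrow> ratfun poly"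
  by unfold_locales (simp_all add: smult_add_right smult_add_left)

definition is_ring_hom :: "('a::comm_ring_1 \<Rightarrow> 'b::comm_ring_1) \<Rightarrow> bool" where
  "is_ring_hom f \<longleftrightarrow> f 1 = 1 \<and> (\<forall>a b. f (a + b) = f a + f b) \<and> (\<forall>a b. f (a * b) = f a * f b)"

lemma is_ring_homD:
  assumes "is_ring_hom f"
  shows "f 1 = 1" "f (a + b) = f a + f b" "f (a * b) = f a * f b" "f 0 = 0" "f (- a) = - f a"
proof -
  show *: "f 1 = 1" "f (a + b) = f a + f b" "f (a * b) = f a * f b" for a b
    using assms by (auto simp: is_ring_hom_def)
  have "f (0 + 0) = f 0 + f 0" by (rule *)
  thus 0: "f 0 = 0" by simp
  have "f (a + - a) = f a + f (- a)" by (rule *)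
  thus "f (- a) = - f a" using 0 by (simp add: eq_neg_iff_add_eq_0 add.commute)
qed

lemma is_ring_hom_comp: "is_ring_hom f \<Longrightarrow> is_ring_hom g \<Longrightarrow> is_ring_hom (\<lambda>x. f (g x))"
  by (simp add: is_ring_hom_def)

lemma is_ring_hom_sum: "is_ring_hom f \<Longrightarrow> f (sum g A) = (\<Sum>x\<in>A. f (g x))"
  by (induction A rule: infinite_finite_induct) (auto simp: is_ring_homD)

lemma is_ring_hom_map_poly:
  assumes "is_ring_hom f"
  shows "is_ring_hom (map_poly f)"
  unfolding is_ring_hom_def
  by (auto simp: poly_eq_iff coeff_map_poly is_ring_homD[OF assms] coeff_mult is_ring_hom_sum[OF assms]
        simp flip: one_pCons)

lemma is_ring_hom_const: "is_ring_hom (\<lambda>c :: rat. to_fract [:c:])"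
  unfolding is_ring_hom_def by (auto simp flip: to_fract_add to_fract_mult simp: pCons_one)

lemma is_ring_hom_pcompose: "is_ring_hom (\<lambda>P :: 'a :: comm_ring_1 poly. pcompose P R)"
  by (auto simp: is_ring_hom_def pcompose_add pcompose_mult pcompose_1)

lemma is_ring_hom_eval_inverse_q: "is_ring_hom eval_inverse_q"
  using is_ring_hom_map_poly[OF is_ring_hom_const]
  by (auto simp: is_ring_hom_def eval_inverse_q_def)

lemma qq_nonzero [simp]: "qq \<noteq> 0"
  by (simp add: qq_def)

lemma poly_const_qq: "poly (map_poly (\<lambda>c. to_fract [:c:]) p) qq = to_fract p"
proof (induction p)
  case (pCons a p)
  have "to_fract (pCons a p) = to_fract ([:a:] + [:0, 1:] * p)" by simp
  also have "\<dots> = to_fract [:a:] + qq * to_fract p"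
    unfolding qq_def by (simp only: to_fract_add to_fract_mult)
  finally show ?case using pCons by (simp add: map_poly_pCons)
qed simp

lemma eval_inverse_q_eq_0_iff [simp]: "eval_inverse_q p = 0 \<longleftrightarrow> p = 0"
proof -
  let ?\<iota> = "\<lambda>c :: rat. to_fract [:c:]"
  have deg: "degree (map_poly ?\<iota> p) = degree p"
    by (rule degree_map_poly) auto
  have "reflect_poly (map_poly ?\<iota> p) = map_poly ?\<iota> (reflect_poly p)"
    by (simp add: poly_eq_iff coeff_reflect_poly coeff_map_poly deg)
  hence "to_fract (reflect_poly p) = poly (reflect_poly (map_poly ?\<iota> p)) qq"
    by (simp add: poly_const_qq)
  also have "\<dots> = qq ^ degree p * eval_inverse_q p"
    by (simp add: poly_reflect_poly_nz eval_inverse_q_def deg)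
  finally show ?thesis by (metis mult_eq_0_iff power_not_zero qq_nonzero reflect_poly_eq_0_iff
        to_fract_eq_0_iff)
qed

lemma bar_ratfun_Fract:
  assumes "b \<noteq> 0"
  shows "bar_ratfun (Fract a b) = eval_inverse_q a / eval_inverse_q b"
proof -
  define c d where "c = fst (quot_of_fract (Fract a b))" and "d = snd (quot_of_fract (Fract a b))"
  have d: "d \<noteq> 0" and "Fract c d = Fract a b" by (simp_all add: c_def d_def)
  hence "c * b = a * d" using assms by (simp add: eq_fract)
  hence "eval_inverse_q c * eval_inverse_q b = eval_inverse_q a * eval_inverse_q d"
    by (metis is_ring_homD(3)[OF is_ring_hom_eval_inverse_q])
  thus ?thesis using d assms
    by (simp add: bar_ratfun_def c_def[symmetric] d_def[symmetric] field_simps)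
qed

lemma is_ring_hom_bar_ratfun: "is_ring_hom bar_ratfun"
proof -
  note E = is_ring_homD[OF is_ring_hom_eval_inverse_q]
  have "bar_ratfun 1 = 1" by (simp add: One_fract_def bar_ratfun_Fract E)
  moreover have "bar_ratfun (x + y) = bar_ratfun x + bar_ratfun y" for x y
    by (cases x; cases y) (simp add: bar_ratfun_Fract E field_simps)
  moreover have "bar_ratfun (x * y) = bar_ratfun x * bar_ratfun y" for x y
    by (cases x; cases y) (simp add: bar_ratfun_Fract E field_simps)
  ultimately show ?thesis by (simp add: is_ring_hom_def)
qed

lemma bar_ratfun_qq [simp]: "bar_ratfun qq = inverse qq"
  unfolding qq_def to_fract_def
  by (simp add: bar_ratfun_Fract) (simp add: eval_inverse_q_def map_poly_pCons qq_def to_fract_def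
    flip: One_fract_def Zero_fract_def one_pCons)

lemma ratfun_hom_unique:
  fixes f g :: "ratfun \<Rightarrow> 'b :: idom"
  assumes f: "is_ring_hom f" and g: "is_ring_hom g" and q: "f qq = g qq"
  shows "f = g"
proof -
  note F = is_ring_homD[OF f] and G = is_ring_homD[OF g]
  have quot: "f (x / y) = g (x / y)" if "f x = g x" "f y = g y" "y \<noteq> 0" for x y
  proof -
    have "f (x / y) * f y = f x" "g (x / y) * g y = g x" "f (1 / y) * f y = 1"
      using \<open>y \<noteq> 0\<close> by (simp_all add: F(1) flip: F(3) G(3))
    moreover from this(3) have "f y \<noteq> 0" by auto
    ultimately show ?thesis using that(1,2) by (metis mult_cancel_right)
  qed
  have nat: "f (of_nat n) = g (of_nat n)" for n
    by (induction n) (simp_all add: F G)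
  have int: "f (of_int n) = g (of_int n)" for n
    by (cases n rule: int_cases2) (simp_all add: F G nat)
  note C = is_ring_homD[OF is_ring_hom_const]
  have of_int_const: "to_fract [:of_int n :: rat:] = of_int n" for n
  proof -
    have nat': "to_fract [:of_nat n :: rat:] = of_nat n" for n
      by (induction n) (use C in \<open>simp_all del: to_fract_0 to_fract_1\<close>)
    show ?thesis by (cases n rule: int_cases2) (use nat' C(5) in auto)
  qed
  have const: "f (to_fract [:c:]) = g (to_fract [:c:])" for c :: rat
  proof (cases c)
    case (Fract a b)
    hence b: "b \<noteq> 0" and c: "c * of_int b = of_int a" by (auto simp: Fract_of_int_quotient)
    have "to_fract [:c:] * of_int b = of_int a"
      unfolding of_int_const[symmetric] C(3)[symmetric] c ..
    moreover have "(of_int b :: ratfun) \<noteq> 0"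
      using b by (simp flip: of_int_const)
    ultimately have "to_fract [:c:] = of_int a / of_int b" "(of_int b :: ratfun) \<noteq> 0"
      by (simp_all add: field_simps)
    thus ?thesis using quot int by metis
  qed
  have pol: "f (to_fract p) = g (to_fract p)" for p
  proof (induction p)
    case (pCons a p)
    have "to_fract (pCons a p) = to_fract ([:a:] + [:0, 1:] * p)" by simp
    also have "\<dots> = to_fract [:a:] + qq * to_fract p"
      unfolding qq_def by (simp only: to_fract_add to_fract_mult)
    finally show ?case using pCons by (simp add: F G q const)
  qed (simp add: F G)
  show ?thesis
  proof
    fix x show "f x = g x"
    proof (cases x)
      case (Fract a b)
      hence "x = to_fract a / to_fract b" by (simp add: to_fract_def)
      thus ?thesis using quot pol Fract by simp
    qed
  qed
qed

lemma bar_ratfun_bar_ratfun [simp]: "bar_ratfun (bar_ratfun f) = f"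
proof -
  have "bar_ratfun (inverse qq) * bar_ratfun qq = 1"
    unfolding is_ring_homD(3)[OF is_ring_hom_bar_ratfun, symmetric]
    by (simp add: is_ring_homD(1)[OF is_ring_hom_bar_ratfun])
  hence "bar_ratfun (inverse qq) = qq" by (simp add: field_simps)
  hence "(\<lambda>f. bar_ratfun (bar_ratfun f)) = (\<lambda>f. f)"
    by (intro ratfun_hom_unique is_ring_hom_comp[OF is_ring_hom_bar_ratfun is_ring_hom_bar_ratfun])
       (simp_all add: is_ring_hom_def)
  thus ?thesis by metis
qed

lemma is_ring_hom_qbar: "is_ring_hom qbar"
  unfolding qbar_def
  by (rule is_ring_hom_comp[OF is_ring_hom_pcompose is_ring_hom_map_poly[OF is_ring_hom_bar_ratfun]])

lemma qbar_const [simp]: "qbar [:c:] = [:bar_ratfun c:]"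
  by (simp add: qbar_def map_poly_pCons pcompose_pCons is_ring_homD[OF is_ring_hom_bar_ratfun])

lemma qbar_x: "qbar [:0, 1:] = [:0, - qq:]"
  by (simp add: qbar_def map_poly_pCons pcompose_pCons is_ring_homD[OF is_ring_hom_bar_ratfun])

lemma ratfun_poly_hom_unique:
  fixes f g :: "ratfun poly \<Rightarrow> ratfun poly"
  assumes f: "is_ring_hom f" and g: "is_ring_hom g"
    and q: "f [:qq:] = g [:qq:]" and x: "f [:0, 1:] = g [:0, 1:]"
  shows "f = g"
proof
  fix P
  have c: "is_ring_hom (\<lambda>c :: ratfun. [:c:])" by (auto simp: is_ring_hom_def one_pCons)
  have const: "f [:c:] = g [:c:]" for c
    using ratfun_hom_unique[OF is_ring_hom_comp[OF f c] is_ring_hom_comp[OF g c] q] by metis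
  show "f P = g P"
  proof (induction P)
    case (pCons a P)
    have "pCons a P = [:a:] + [:0, 1:] * P" by simp
    hence "f (pCons a P) = f [:a:] + f [:0, 1:] * f P" "g (pCons a P) = g [:a:] + g [:0, 1:] * g P"
      by (simp_all only: is_ring_homD(2,3)[OF f] is_ring_homD(2,3)[OF g])
    thus ?case by (simp only: const x pCons(2))
  qed (simp add: is_ring_homD[OF f] is_ring_homD[OF g])
qed

theorem qbar_unique:
  assumes "is_ring_hom f" "f [:qq:] = [:inverse qq:]" "f [:0, 1:] = [:0, - qq:]"
  shows "f = qbar"
  by (rule ratfun_poly_hom_unique) (use assms in \<open>simp_all add: is_ring_hom_qbar qbar_x\<close>)

theorem qbar_qbar [simp]: "qbar (qbar P) = P"
proof -
  have "qbar (qbar [:0, 1:]) = [:0, 1:]"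
    by (simp add: qbar_x) (simp add: qbar_def map_poly_pCons pcompose_pCons
      is_ring_homD[OF is_ring_hom_bar_ratfun])
  hence "(\<lambda>P. qbar (qbar P)) = (\<lambda>P. P)"
    by (intro ratfun_poly_hom_unique is_ring_hom_comp[OF is_ring_hom_qbar is_ring_hom_qbar])
       (simp_all add: is_ring_hom_def del: bar_ratfun_qq)
  thus ?thesis by metis
qed

theorem is_ring_hom_qshift: "is_ring_hom qshift"
  unfolding qshift_def by (rule is_ring_hom_pcompose)

theorem qshift_smult: "qshift (smult c P) = smult c (qshift P)"
  by (simp add: qshift_def pcompose_smult)

theorem qshift_x: "qshift [:0, 1:] = [:1, qq:]"
  by (simp add: qshift_def pcompose_pCons)

theorem bij_qshift: "bij qshift"
  and inv_qshift: "inv qshift P = pcompose P [:- inverse qq, inverse qq:]"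
proof -
  have 1: "qshift (pcompose P [:- inverse qq, inverse qq:]) = P" for P
    by (simp add: qshift_def pcompose_pCons flip: pcompose_assoc)
  have 2: "pcompose (qshift P) [:- inverse qq, inverse qq:] = P" for P
    by (simp add: qshift_def pcompose_pCons flip: pcompose_assoc)
  show "bij qshift" by (rule o_bij[of "\<lambda>P. pcompose P [:- inverse qq, inverse qq:]"]) (auto simp: 1 2)
  thus "inv qshift P = pcompose P [:- inverse qq, inverse qq:]"
    by (metis 1 bij_inv_eq_iff)
qed

end

theory Submission
  imports Defs
begin

text \<open>
  Write \<open>B k\<close> for the bar of the \<open>k\<close>-th \<open>q\<close>-binomial polynomial. The bar of the linear factor
  \<open>x - [j]\<close> is, up to a unit, \<open>q^j x + [j] = S^j x\<close>, so \<open>B k\<close> is a scalar multiple of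
  \<open>x (S x) \<dots> (S^(k-1) x)\<close>. Applying the inverse shift to this product exchanges its last factor for
  the new first factor \<open>S^(-1) x\<close> (lemma \<open>inv_qshift_barred_binom_Suc\<close>), and comparing the two
  linear factors gives the case \<open>m = 1\<close> (lemma \<open>inv_qshift_barred_binom\<close>):

  \<open>S^(-1) (B k) = q^(-k) B k + B (k - 1)\<close>.

  Both claims follow by iterating this relation. Applying \<open>S^(-1)\<close> to the expansion of
  \<open>S^(-m) (B k)\<close> yields the Pascal recurrence of the \<open>q\<close>-binomial coefficients, which gives the closed
  formula. Positivity does not have to be read off from that formula, where one would need the
  degree of the Gaussian polynomials: applying \<open>S^(-m)\<close> to the relation shows that the coordinates
  obey a recursion whose only coefficients are \<open>q^(-k)\<close> and \<open>1\<close>. Finally, the \<open>B k\<close> form a basis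
  because \<open>B k\<close> has degree exactly \<open>k\<close>.
\<close>

section \<open>Arithmetic of \<open>q\<close>-integers\<close>

lemma qq_power_eq_1_iff: "qq ^ n = 1 \<longleftrightarrow> n = 0"
proof
  have pow: "qq ^ n = to_fract ([:0, 1:] ^ n)"
    by (induction n) (simp_all only: qq_def power_0 power_Suc to_fract_1 to_fract_mult)
  assume "qq ^ n = 1"
  hence "([:0, 1:] :: rat poly) ^ n = 1"
    unfolding pow by (metis to_fract_1 to_fract_eq_iff)
  hence "degree (([:0, 1:] :: rat poly) ^ n) = 0" by simp
  thus "n = 0" by (simp add: degree_power_eq)
qed simp

lemma qq_minus_1_nonzero: "qq - 1 \<noteq> 0"
  using qq_power_eq_1_iff[of 1] by simp

lemma qint_eq_0_iff: "qint n = 0 \<longleftrightarrow> n = 0"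
  using qq_power_eq_1_iff[of n] qq_minus_1_nonzero by (simp add: qint_def)

lemma qint_0: "qint 0 = 0" and qint_1: "qint (Suc 0) = 1"
  using qq_minus_1_nonzero by (simp_all add: qint_def)

lemma qint_add: "qint (a + b) = qq ^ a * qint b + qint a"
  by (simp add: qint_def power_add field_simps flip: add_divide_distrib)

lemma qint_Suc: "qint (Suc n) = qint n + qq ^ n"
  using qint_add[of n 1] by (simp add: qint_1)

lemma qint_Suc': "qint (Suc n) = 1 + qq * qint n"
  using qint_add[of 1 n] by (simp add: qint_1)

lemma qfact_Suc: "qfact (Suc n) = qint (Suc n) * qfact n"
  by (simp add: qfact_def mult.commute)

lemma qfact_nonzero: "qfact n \<noteq> 0"
  by (auto simp: qfact_def qint_eq_0_iff)

lemma qbinom_0: "qbinom n 0 = 1"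
  using qfact_nonzero[of n] by (simp add: qbinom_def) (simp add: qfact_def)

lemma qbinom_pascal: "qbinom (Suc n) (Suc k) = qq ^ Suc k * qbinom n (Suc k) + qbinom n k"
proof (cases k n rule: linorder_cases)
  case less
  then obtain d where n: "n = Suc k + d" using less_iff_Suc_add by auto
  have split: "qint (Suc n) = qq ^ Suc k * qint (Suc d) + qint (Suc k)"
    using qint_add[of "Suc k" "Suc d"] by (simp add: n)
  have "qbinom (Suc n) (Suc k) = qint (Suc n) * qfact n / (qint (Suc d) * qfact d * (qint (Suc k) * qfact k))"
    and "qbinom n (Suc k) = qfact n / (qfact d * (qint (Suc k) * qfact k))"
    and "qbinom n k = qfact n / (qint (Suc d) * qfact d * qfact k)"
    by (simp_all add: qbinom_def n qfact_Suc Suc_diff_le)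
  moreover have "(u * s + t) * N / (s * D * (t * K)) = u * (N / (D * (t * K))) + N / (s * D * K)"
    if "s \<noteq> 0" "t \<noteq> 0" "D \<noteq> 0" "K \<noteq> 0" for u s t N D K :: ratfun
    using that by (simp add: field_simps)
  ultimately show ?thesis
    unfolding split by (simp only: qfact_nonzero qint_eq_0_iff nat.distinct not_False_eq_True)
next
  case equal
  thus ?thesis using qfact_nonzero[of k] qfact_nonzero[of "Suc k"]
    by (simp add: qbinom_def)
qed (simp add: qbinom_def)

lemma bar_ratfun_power: "bar_ratfun (a ^ n) = bar_ratfun a ^ n"
  by (induction n) (simp_all add: is_ring_homD[OF is_ring_hom_bar_ratfun])

lemma bar_ratfun_qint: "qq ^ n * bar_ratfun (qint n) = qq * qint n"
proof (induction n)
  case (Suc n)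
  have "qq ^ Suc n * bar_ratfun (qint (Suc n))
      = qq * (qq ^ n * bar_ratfun (qint n)) + qq ^ Suc n * inverse qq ^ n"
    by (simp add: qint_Suc is_ring_homD(2)[OF is_ring_hom_bar_ratfun] bar_ratfun_power algebra_simps)
  also have "\<dots> = qq * (1 + qq * qint n)"
    unfolding Suc.IH by (simp add: power_inverse algebra_simps)
  finally show ?case by (simp add: qint_Suc')
qed (simp add: qint_0 is_ring_homD(4)[OF is_ring_hom_bar_ratfun])

section \<open>The barred \<open>q\<close>-binomial polynomials and the inverse shift\<close>

abbreviation barred_binom :: "int \<Rightarrow> ratfun poly" where
  "barred_binom k \<equiv> qbar (qbinom_poly k)"

lemma barred_binom_neg: "k < 0 \<Longrightarrow> barred_binom k = 0"
  by (simp add: qbinom_poly_def is_ring_homD(4)[OF is_ring_hom_qbar])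

lemma barred_binom_0: "barred_binom 0 = 1"
  by (simp add: qbinom_poly_def qfact_def numeral_2_eq_2 is_ring_homD(1)[OF is_ring_hom_qbar]
        flip: one_pCons)

lemma qbar_smult: "qbar (smult c P) = smult (bar_ratfun c) (qbar P)"
  using is_ring_homD(3)[OF is_ring_hom_qbar, of "[:c:]" P] by simp

lemma qbinom_poly_Suc:
  "smult (qq ^ k * qint (Suc k)) (qbinom_poly (int (Suc k))) = qbinom_poly (int k) * [:- qint k, 1:]"
proof -
  have "Suc k choose 2 = k + (k choose 2)" by (simp add: numeral_2_eq_2)
  hence "qq ^ k * qint (Suc k) * (1 / (qq ^ (Suc k choose 2) * qfact (Suc k)))
      = 1 / (qq ^ (k choose 2) * qfact k)"
    using qint_eq_0_iff[of "Suc k"] qfact_nonzero[of k]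
    by (simp add: qfact_Suc power_add field_simps)
  thus ?thesis
    by (simp add: qbinom_poly_def nat_add_distrib lessThan_Suc mult.commute del: of_nat_Suc binomial_Suc_Suc)
qed

text \<open>The bar of the factor \<open>x - [k]\<close> is \<open>-q x - q^(1-k) [k] = -q^(1-k) (q^k x + [k])\<close>, and its bar
  normalisation contributes \<open>q^(2k) / [k+1]\<close>; together they give the scalar below. The linear
  factor on the right is \<open>S^k x\<close>.\<close>

lemma barred_binom_Suc:
  "barred_binom (int (Suc k))
     = smult (- (qq ^ Suc k) / qint (Suc k)) (barred_binom (int k) * [:qint k, qq ^ k:])"
proof -
  define b where "b = bar_ratfun (qint k)"
  define c where "c = bar_ratfun (qint (Suc k))"
  have b: "qq ^ k * b = qq * qint k" and c: "qq ^ k * c = qint (Suc k)"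
    using bar_ratfun_qint[of k] bar_ratfun_qint[of "Suc k"] by (simp_all add: b_def c_def)
  have lin: "qbar [:- qint k, 1:] = [:- b, - qq:]"
    using is_ring_homD(2)[OF is_ring_hom_qbar, of "[:- qint k:]" "[:0, 1:]"]
    by (simp add: qbar_x b_def is_ring_homD(5)[OF is_ring_hom_bar_ratfun])
  have "qbar (smult (qq ^ k * qint (Suc k)) (qbinom_poly (int (Suc k))))
      = qbar (qbinom_poly (int k) * [:- qint k, 1:])"
    by (simp only: qbinom_poly_Suc)
  hence *: "smult (inverse qq ^ k * c) (barred_binom (int (Suc k))) = barred_binom (int k) * [:- b, - qq:]"
    by (simp only: qbar_smult is_ring_homD(3)[OF is_ring_hom_qbar] is_ring_homD(3)[OF is_ring_hom_bar_ratfun]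
          bar_ratfun_power bar_ratfun_qq lin c_def)
  have nz: "qint (Suc k) \<noteq> 0" by (simp add: qint_eq_0_iff)
  have "qq ^ k * qq ^ k / qint (Suc k) * (inverse qq ^ k * c) = 1"
    using c nz by (simp add: power_inverse field_simps)
  hence "barred_binom (int (Suc k))
      = smult (qq ^ k * qq ^ k / qint (Suc k)) (smult (inverse qq ^ k * c) (barred_binom (int (Suc k))))"
    by (simp only: smult_smult smult_1_left)
  also have "\<dots> = smult (qq ^ k * qq ^ k / qint (Suc k)) (barred_binom (int k) * [:- b, - qq:])"
    by (simp only: *)
  also have "\<dots> = barred_binom (int k) * smult (qq ^ k * qq ^ k / qint (Suc k)) [:- b, - qq:]"
    by (simp only: mult_smult_right)
  also have "smult (qq ^ k * qq ^ k / qint (Suc k)) [:- b, - qq:]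
      = smult (- (qq ^ Suc k) / qint (Suc k)) [:qint k, qq ^ k:]"
    using b nz by (simp add: field_simps)
  finally show ?thesis by (simp only: mult_smult_right)
qed

lemma is_ring_hom_inv_qshift: "is_ring_hom (inv qshift)"
  using is_ring_hom_pcompose by (simp add: inv_qshift[abs_def] is_ring_hom_def)

lemma inv_qshift_smult: "inv qshift (smult c P) = smult c (inv qshift P)"
  by (simp add: inv_qshift pcompose_smult)

lemma inv_qshift_linear_Suc: "inv qshift [:qint (Suc k), qq ^ Suc k:] = [:qint k, qq ^ k:]"
  by (simp add: inv_qshift pcompose_pCons qint_Suc)

text \<open>On \<open>x (S x) \<dots> (S^k x)\<close> the inverse shift drops the last factor \<open>S^k x\<close> and prepends
  \<open>S^(-1) x = q^(-1) (x - 1)\<close>, while the normalising scalar is unchanged.\<close>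

lemma inv_qshift_barred_binom_Suc:
  "inv qshift (barred_binom (int (Suc k)))
     = smult (- (qq ^ Suc k) / qint (Suc k)) (barred_binom (int k) * [:- inverse qq, inverse qq:])"
proof (induction k)
  case 0
  have "barred_binom (int (Suc 0)) = smult (- qq) [:0, 1:]"
    using barred_binom_Suc[of 0] by (simp add: barred_binom_0 qint_0 qint_1)
  thus ?case
    by (simp only: inv_qshift_smult) (simp add: inv_qshift pcompose_pCons barred_binom_0 qint_1)
next
  case (Suc k)
  let ?d = "\<lambda>k. - (qq ^ Suc k) / qint (Suc k)"
  have "inv qshift (barred_binom (int (Suc (Suc k))))
      = smult (?d (Suc k)) (inv qshift (barred_binom (int (Suc k))) * [:qint k, qq ^ k:])"
    unfolding barred_binom_Suc[of "Suc k"] inv_qshift_smult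
      is_ring_homD(3)[OF is_ring_hom_inv_qshift] inv_qshift_linear_Suc ..
  also have "\<dots> = smult (?d (Suc k))
      (smult (?d k) (barred_binom (int k) * [:qint k, qq ^ k:]) * [:- inverse qq, inverse qq:])"
    unfolding Suc.IH by (simp only: mult_smult_left mult_smult_right ac_simps)
  finally show ?case unfolding barred_binom_Suc[of k, symmetric] .
qed

text \<open>After cancelling \<open>B k\<close> and the scalar \<open>-q^(k+1) / [k+1]\<close>, this is the identity
  \<open>q^(-1) (x - 1) = q^(-k-1) (q^k x + [k] - [k+1])\<close> of linear polynomials.\<close>

lemma inv_qshift_barred_binom_nat:
  "inv qshift (barred_binom (int (Suc k)))
     = smult (inverse qq ^ Suc k) (barred_binom (int (Suc k))) + barred_binom (int k)"
proof -
  let ?d = "- (qq ^ Suc k) / qint (Suc k)"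
  have nz: "qint (Suc k) \<noteq> 0" by (simp add: qint_eq_0_iff)
  have "smult ?d [:- inverse qq, inverse qq:] = smult (inverse qq ^ Suc k * ?d) [:qint k, qq ^ k:] + 1"
    using nz by (simp add: one_pCons field_simps power_inverse) (simp add: qint_Suc)
  hence "barred_binom (int k) * smult ?d [:- inverse qq, inverse qq:]
      = barred_binom (int k) * (smult (inverse qq ^ Suc k * ?d) [:qint k, qq ^ k:] + 1)"
    by (simp only:)
  thus ?thesis
    unfolding inv_qshift_barred_binom_Suc unfolding barred_binom_Suc[of k]
    by (simp only: distrib_left mult_smult_right smult_smult mult_1_right)
qed

lemma inv_qshift_barred_binom:
  "inv qshift (barred_binom k) = smult (qq powi (- k)) (barred_binom k) + barred_binom (k - 1)"
proof -
  consider "k < 0" | "k = 0" | n where "k = int (Suc n)"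
    by (cases k rule: int_cases3) (auto dest: gr0_implies_Suc simp del: of_nat_Suc)
  thus ?thesis
  proof cases
    case 3
    have "qq powi (- k) = inverse qq ^ Suc n"
      unfolding 3 power_int_minus power_int_of_nat by (simp only: power_inverse)
    thus ?thesis using inv_qshift_barred_binom_nat[of n] by (simp add: 3)
  qed (simp_all add: barred_binom_neg barred_binom_0 is_ring_homD[OF is_ring_hom_inv_qshift])
qed

theorem inv_qshift_power_barred_binom:
  "(inv qshift ^^ m) (barred_binom k)
     = (\<Sum>i\<le>m. smult (qq powi ((int i - int m) * k) * qbinom m i) (barred_binom (k - int i)))"
proof (induction m)
  case 0
  show ?case by (simp add: qbinom_0)
next
  case (Suc m)
  define B where "B = (\<lambda>i :: nat. barred_binom (k - int i))"
  define c where "c = (\<lambda>m i :: nat. qq powi ((int i - int m) * k) * qbinom m i)"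
  define a where "a = (\<lambda>i. c m i * qq powi (int i - k))"
  have step: "inv qshift (B i) = smult (qq powi (int i - k)) (B i) + B (Suc i)" for i
    using inv_qshift_barred_binom[of "k - int i"] by (simp add: B_def algebra_simps)
  have c_0: "c (Suc m) 0 = a 0"
    by (simp add: a_def c_def qbinom_0 algebra_simps flip: power_int_add)
  have c_Suc: "c (Suc m) (Suc i) = a (Suc i) + c m i" for i
  proof -
    have "qq powi ((int i - int m) * k) * qq ^ Suc i
        = qq powi ((int (Suc i) - int m) * k) * qq powi (int (Suc i) - k)"
      unfolding power_int_of_nat[symmetric]
      by (simp add: algebra_simps flip: power_int_add)
    thus ?thesis
      unfolding a_def c_def qbinom_pascal by (simp add: algebra_simps)
  qed
  have top: "a (Suc m) = 0" by (simp add: a_def c_def qbinom_def)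
  have "(inv qshift ^^ Suc m) (barred_binom k) = inv qshift (\<Sum>i\<le>m. smult (c m i) (B i))"
    using Suc.IH by (simp add: c_def B_def)
  also have "\<dots> = (\<Sum>i\<le>m. smult (a i) (B i)) + (\<Sum>i\<le>m. smult (c m i) (B (Suc i)))"
    by (simp add: is_ring_hom_sum[OF is_ring_hom_inv_qshift] inv_qshift_smult step smult_add_right
          a_def sum.distrib)
  also have "(\<Sum>i\<le>m. smult (a i) (B i)) = (\<Sum>i\<le>Suc m. smult (a i) (B i))"
    by (simp add: top)
  also have "\<dots> + (\<Sum>i\<le>m. smult (c m i) (B (Suc i))) = (\<Sum>i\<le>Suc m. smult (c (Suc m) i) (B i))"
    unfolding sum.atMost_Suc_shift
    by (simp add: c_0 c_Suc smult_add_left sum.distrib)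
  finally show ?case by (simp only: c_def B_def)
qed

section \<open>Polynomial sequences with exact degrees are bases\<close>

lemma degree_less_subspace: "ratfun_poly.subspace {p. p = 0 \<or> degree p < n}"
  unfolding ratfun_poly.subspace_def
  by (auto intro: le_less_trans[OF degree_add_le_max] le_less_trans[OF degree_smult_le])

lemma
  fixes e :: "nat \<Rightarrow> ratfun poly"
  assumes nz: "\<And>n. e n \<noteq> 0" and deg: "\<And>n. degree (e n) = n"
  shows exact_degree_inj: "inj e"
    and exact_degree_independent: "ratfun_poly.independent (range e)"
    and exact_degree_span: "ratfun_poly.span (range e) = UNIV"
proof -
  show "inj e" by (metis deg injI)
  have indep: "ratfun_poly.independent (e ` {..<n})" for n
  proof (induction n)
    case (Suc n)
    have "ratfun_poly.span (e ` {..<n}) \<subseteq> {p. p = 0 \<or> degree p < n}"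
      by (rule ratfun_poly.span_minimal[OF _ degree_less_subspace]) (auto simp: deg)
    moreover have "e n \<notin> {p. p = 0 \<or> degree p < n}" by (simp add: nz deg)
    ultimately have "e n \<notin> ratfun_poly.span (e ` {..<n})" by blast
    thus ?case
      unfolding lessThan_Suc image_insert using Suc by (rule ratfun_poly.independent_insertI)
  qed (simp add: ratfun_poly.independent_empty)
  have "ratfun_poly.independent (\<Union>n. e ` {..<n})"
  proof (rule ratfun_poly.independent_Union_directed)
    fix X Y assume "X \<in> range (\<lambda>n. e ` {..<n})" "Y \<in> range (\<lambda>n. e ` {..<n})"
    then obtain a b where "X = e ` {..<a}" "Y = e ` {..<b}" by auto
    thus "X \<subseteq> Y \<or> Y \<subseteq> X" by (cases a b rule: le_cases) auto
  next
    fix X assume "X \<in> range (\<lambda>n. e ` {..<n})"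
    thus "ratfun_poly.independent X" using indep by blast
  qed
  moreover have "(\<Union>n. e ` {..<n}) = range e" by auto
  ultimately show "ratfun_poly.independent (range e)" by simp
  have "p \<in> ratfun_poly.span (range e)" if "p = 0 \<or> degree p < n" for p n
    using that
  proof (induction n arbitrary: p)
    case (Suc n)
    define s where "s = coeff p n / coeff (e n) n"
    have "coeff (e n) n \<noteq> 0" using nz[of n] deg[of n] by (metis leading_coeff_0_iff)
    hence "coeff (p - smult s (e n)) n = 0" by (simp add: s_def)
    moreover have "degree (p - smult s (e n)) \<le> n"
      using Suc.prems by (intro degree_diff_le) (auto simp: deg)
    ultimately have "p - smult s (e n) = 0 \<or> degree (p - smult s (e n)) < n"
      by (metis leading_coeff_0_iff le_neq_implies_less)
    hence "p - smult s (e n) \<in> ratfun_poly.span (range e)" by (rule Suc.IH)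
    hence "(p - smult s (e n)) + smult s (e n) \<in> ratfun_poly.span (range e)"
      by (rule ratfun_poly.span_add[OF _ ratfun_poly.span_scale[OF ratfun_poly.span_base[OF rangeI]]])
    thus ?case by simp
  qed (simp add: ratfun_poly.span_zero)
  thus "ratfun_poly.span (range e) = UNIV" by blast
qed

lemma barred_binom_degree:
  "barred_binom (int k) \<noteq> 0 \<and> degree (barred_binom (int k)) = k"
proof (induction k)
  case (Suc k)
  have "- (qq ^ Suc k) / qint (Suc k) \<noteq> 0" by (simp add: qint_eq_0_iff)
  moreover have "[:qint k, qq ^ k:] \<noteq> 0" "degree [:qint k, qq ^ k:] = 1" by simp_all
  hence "barred_binom (int k) * [:qint k, qq ^ k:] \<noteq> 0"
    and "degree (barred_binom (int k) * [:qint k, qq ^ k:]) = Suc k"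
    using Suc degree_mult_eq[of "barred_binom (int k)" "[:qint k, qq ^ k:]"]
    by (metis mult_eq_0_iff, metis Suc_eq_plus1)
  ultimately show ?case
    unfolding barred_binom_Suc by (metis degree_smult_eq smult_eq_0_iff)
qed (simp add: barred_binom_0)

section \<open>Positivity of the coordinates\<close>

lemma nat_polys_0: "0 \<in> nat_polys_in_inverse_q"
  unfolding nat_polys_in_inverse_q_def by (rule range_eqI[of _ _ 0]) simp

lemma nat_polys_1: "1 \<in> nat_polys_in_inverse_q"
  unfolding nat_polys_in_inverse_q_def by (rule range_eqI[of _ _ 1]) simp

lemma nat_polys_add:
  assumes "a \<in> nat_polys_in_inverse_q" "b \<in> nat_polys_in_inverse_q"
  shows "a + b \<in> nat_polys_in_inverse_q"
proof -
  have "map_poly of_nat (p + r) = (map_poly of_nat p + map_poly of_nat r :: ratfun poly)" for p r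
    by (simp add: poly_eq_iff coeff_map_poly)
  thus ?thesis using assms unfolding nat_polys_in_inverse_q_def
    by (auto simp flip: poly_add) (metis poly_add rangeI)
qed

lemma nat_polys_inverse_mult:
  assumes "a \<in> nat_polys_in_inverse_q"
  shows "inverse qq * a \<in> nat_polys_in_inverse_q"
proof -
  obtain p :: "nat poly" where "a = poly (map_poly of_nat p) (inverse qq)"
    using assms by (auto simp: nat_polys_in_inverse_q_def)
  hence "inverse qq * a = poly (map_poly of_nat (pCons 0 p)) (inverse qq)"
    by (simp add: map_poly_pCons)
  thus ?thesis unfolding nat_polys_in_inverse_q_def by blast
qed

lemma nat_polys_inverse_power_mult:
  "a \<in> nat_polys_in_inverse_q \<Longrightarrow> inverse qq ^ n * a \<in> nat_polys_in_inverse_q"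
  by (induction n) (simp_all add: nat_polys_inverse_mult mult.assoc)

text \<open>Applying \<open>S^(-m)\<close> to \<open>S^(-1) (B k) = q^(-k) B k + B (k - 1)\<close> expresses the coordinates at
  \<open>m + 1\<close> through those at \<open>m\<close>, for \<open>k\<close> and \<open>k - 1\<close>, by additions and multiplications by \<open>q^(-k)\<close>
  only; hence the induction on \<open>m\<close> with \<open>k\<close> arbitrary.\<close>

lemma barred_binom_coordinates:
  assumes indep: "ratfun_poly.independent (range (\<lambda>j. barred_binom (int j)))"
    and span: "ratfun_poly.span (range (\<lambda>j. barred_binom (int j))) = UNIV"
  shows "ratfun_poly.representation (range (\<lambda>j. barred_binom (int j)))
           ((inv qshift ^^ m) (barred_binom (int k))) v \<in> nat_polys_in_inverse_q"
proof (induction m arbitrary: k)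
  case 0
  have "barred_binom (int k) \<in> range (\<lambda>j. barred_binom (int j))" by blast
  thus ?case
    by (simp add: ratfun_poly.representation_basis[OF indep] nat_polys_0 nat_polys_1)
next
  case (Suc m)
  have lin: "(inv qshift ^^ n) (smult c P + Q) = smult c ((inv qshift ^^ n) P) + (inv qshift ^^ n) Q"
    for n c P Q
    by (induction n) (simp_all add: inv_qshift_smult is_ring_homD(2)[OF is_ring_hom_inv_qshift])
  show ?case
  proof (cases k)
    case 0
    hence "inv qshift (barred_binom (int k)) = barred_binom (int k)"
      by (simp add: barred_binom_0 is_ring_homD(1)[OF is_ring_hom_inv_qshift])
    thus ?thesis using Suc[of k] by (simp add: funpow_Suc_right del: funpow.simps)
  next
    case (Suc l)
    have "(inv qshift ^^ Suc m) (barred_binom (int k))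
        = smult (inverse qq ^ k) ((inv qshift ^^ m) (barred_binom (int k)))
          + (inv qshift ^^ m) (barred_binom (int l))"
      unfolding funpow_Suc_right o_apply Suc inv_qshift_barred_binom_nat lin ..
    thus ?thesis
      using Suc.IH by (simp only: ratfun_poly.representation_add[OF indep]
          ratfun_poly.representation_scale[OF indep] span UNIV_I nat_polys_add
          nat_polys_inverse_power_mult)
  qed
qed

theorem mainTheorem9:
  shows "(\<forall>m k :: nat.
            (inv qshift ^^ m) (qbar (qbinom_poly (int k))) =
            (\<Sum>i=0..m. smult (qq powi ((int i - int m) * int k) * qbinom m i)
                              (qbar (qbinom_poly (int k - int i)))))
       \<and> (let e = (\<lambda>j :: nat. qbar (qbinom_poly (int j))) in
            inj e \<and> ratfun_poly.independent (range e) \<and> ratfun_poly.span (range e) = UNIV \<and>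
            (\<forall>m k j :: nat.
               ratfun_poly.representation (range e) ((inv qshift ^^ m) (e k)) (e j)
                 \<in> nat_polys_in_inverse_q))"
proof -
  note basis = exact_degree_inj exact_degree_independent exact_degree_span
  note basis = basis[of "\<lambda>j. barred_binom (int j)", OF conjunct1 conjunct2,
      OF barred_binom_degree barred_binom_degree]
  show ?thesis
    unfolding Let_def
    using inv_qshift_power_barred_binom basis barred_binom_coordinates[OF basis(2,3)]
    by (simp add: atLeast0AtMost)
qed

end
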